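(* Let $n\ge 1$, and let $m\ge0$ and $2\le k\le n+1$ be integers. The arrangement of affine hyperplanes in $\mathbb{R}^n$ consisting of the hyperplanes $x_1-x_j=0,1,\ldots,m$ for $2\le j<k$, the hyperplanes $x_1-x_j=0,1,\ldots,m+1$ for $k\le j\le n$, and the hyperplanes $x_i-x_j=0$ and $x_i-x_j=1$ for $2\le i<j\le n$, has exactly $(n+m)^{k-2}(n+m+1)^{n-k+1}$ regions. In particular (taking $m=0$, $k=2$), the Shi arrangement in $\mathbb{R}^n$, consisting of the hyperplanes $x_i-x_j=0$ and $x_i-x_j=1$ for $1\le i<j\le n$, has $(n+1)^{n-1}$ regions.
   Context: A region of a finite arrangement of affine hyperplanes in $\mathbb{R}^n$ is a connected component of the complement of the union of its hyperplanes. *)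

theory Defs
  imports "HOL-Analysis.Analysis"
begin

text \<open>R^n is modelled as the points x :: nat \<Rightarrow> real with x i = 0 for i outside {1..n}
  (coordinates x_1..x_n), with the (product) topology of nat \<Rightarrow> real, which on this
  subspace is the Euclidean topology.\<close>

definition Rn :: "nat \<Rightarrow> (nat \<Rightarrow> real) set" where
  "Rn n = {x. \<forall>i. i \<notin> {1..n} \<longrightarrow> x i = 0}"

definition hyp :: "nat \<Rightarrow> nat \<Rightarrow> nat \<Rightarrow> real \<Rightarrow> (nat \<Rightarrow> real) set" where
  "hyp n i j c = {x \<in> Rn n. x i - x j = c}"

definition regions :: "nat \<Rightarrow> (nat \<Rightarrow> real) set set \<Rightarrow> (nat \<Rightarrow> real) set set" where
  "regions n A = {connected_component_set (Rn n - \<Union>A) x | x. x \<in> Rn n - \<Union>A}"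

definition arr :: "nat \<Rightarrow> nat \<Rightarrow> nat \<Rightarrow> (nat \<Rightarrow> real) set set" where
  "arr n m k =
     {hyp n 1 j (real c) | j c. 2 \<le> j \<and> j < k \<and> c \<le> m}
   \<union> {hyp n 1 j (real c) | j c. k \<le> j \<and> j \<le> n \<and> c \<le> m + 1}
   \<union> {hyp n i j c | i j c. 2 \<le> i \<and> i < j \<and> j \<le> n \<and> (c = 0 \<or> c = 1)}"

definition shi :: "nat \<Rightarrow> (nat \<Rightarrow> real) set set" where
  "shi n = {hyp n i j c | i j c. 1 \<le> i \<and> i < j \<and> j \<le> n \<and> (c = 0 \<or> c = 1)}"

end

theory Submission
  imports Defs "HOL-Library.Function_Algebras"
begin

text \<open>Regions are convex and relatively open along lines. Hence a further hyperplane $H$ cuts each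
  region that it meets into exactly two, and its intersections with these regions are the regions
  of the restricted arrangement in $H$. So deleting $H$ lowers the number of regions by the number
  of regions of the restriction to $H$.

  Deleting the hyperplane $x_1 - x_k = m+1$
  from the arrangement with parameters $(n,m,k)$ leaves the one with parameters $(n,m,k+1)$;
  restricting to it, i.e. substituting $x_k = x_1 - m - 1$, turns $x_i - x_k = 0, 1$
  and $x_k - x_j = 0, 1$ into $x_1 - x_i = m+1, m$ and $x_1 - x_j = m+1, m+2$, which gives the
  arrangement with parameters $(n-1,m+1,k)$. Since $(n,m,2)$ and $(n,m+1,n+1)$ describe the same
  arrangement, this reduces everything to $(n,0,n+1)$. There $x_1$ is only compared with
  $x_2,\ldots,x_n$ by order, and each of these $n-1$ comparisons adds as many regions
  as the Shi arrangement in $x_2,\ldots,x_n$ has.\<close>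

instantiation "fun" :: (type, real_vector) real_vector
begin

definition scaleR_fun_def: "r *\<^sub>R f = (\<lambda>x. r *\<^sub>R f x)"

instance
  by standard (simp_all add: scaleR_fun_def fun_eq_iff algebra_simps)

end

lemma scaleR_fun_apply [simp]: "(r *\<^sub>R f) x = r *\<^sub>R f x"
  by (simp add: scaleR_fun_def)

section \<open>Components cut by a hyperplane\<close>

lemma continuous_on_line:
  fixes x y :: "'i \<Rightarrow> real"
  shows "continuous_on T (\<lambda>t. (1 - t) *\<^sub>R x + t *\<^sub>R y)"
  by (rule continuous_on_coordinatewise_then_product) (auto intro!: continuous_intros)

text \<open>The library fact \<open>convex_connected\<close> is about normed spaces, which \<^typ>\<open>'i \<Rightarrow> real\<close> is not.\<close>

lemma convex_imp_connected_fun: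
  fixes S :: "('i \<Rightarrow> real) set"
  assumes "convex S"
  shows "connected S"
  unfolding connected_iff_connected_component
proof (intro ballI)
  fix x y assume "x \<in> S" "y \<in> S"
  then have "closed_segment x y \<subseteq> S"
    using assms by (simp add: convex_contains_segment)
  moreover have "connected (closed_segment x y)"
    unfolding closed_segment_image_interval
    by (intro connected_continuous_image continuous_on_line connected_Icc)
  ultimately show "connected_component S x y"
    by (meson connected_component_def ends_in_segment)
qed

lemma connected_on_one_side_of_level_set:
  fixes f :: "'a::topological_space \<Rightarrow> real"
  assumes "connected S" "continuous_on S f" "c \<notin> f ` S"
  shows "S \<subseteq> {x. f x < c} \<or> S \<subseteq> {x. c < f x}"
proof (rule ccontr)
  assume "\<not> ?thesis"
  then obtain x y where "x \<in> S" "y \<in> S" "c \<le> f x" "f y \<le> c"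
    by (simp add: subset_eq not_less) blast
  moreover have "connected (f ` S)"
    using assms by (simp add: connected_continuous_image)
  ultimately have "c \<in> f ` S"
    by (meson connected_iff_interval imageI)
  with assms(3) show False ..
qed

lemma connected_meets_level_set:
  fixes f :: "'a::topological_space \<Rightarrow> real"
  assumes "connected S" "continuous_on S f" "S \<inter> {x. f x < c} \<noteq> {}" "S \<inter> {x. c < f x} \<noteq> {}"
  shows "S \<inter> {x. f x = c} \<noteq> {}"
  using connected_on_one_side_of_level_set[OF assms(1,2), of c] assms(3,4) by fastforce

lemma convex_linear_sides:
  assumes "linear f"
  shows "convex {x. f x < (c::real)}" "convex {x. c < f x}" "convex {x. f x = c}"
  using convex_linear_vimage[OF assms, of "{..<c}"] convex_linear_vimage[OF assms, of "{c<..}"]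
    convex_linear_vimage[OF assms, of "{c}"]
  by (simp_all add: vimage_def)

lemma components_Diff_level_set:
  fixes f :: "'a::topological_space \<Rightarrow> real"
  assumes "continuous_on G f"
  shows "components (G - {x. f x = c})
       = components (G \<inter> {x. f x < c}) \<union> components (G \<inter> {x. c < f x})"
    (is "components ?D = components ?L \<union> components ?U")
proof -
  have sides: "S \<subseteq> ?L \<or> S \<subseteq> ?U" if "connected S" "S \<subseteq> ?D" for S
    using connected_on_one_side_of_level_set[OF that(1), of f c] that(2)
      continuous_on_subset[OF assms, of S]
    by auto
  have "components ?D \<subseteq> components ?L \<union> components ?U"
  proof
    fix C assume C: "C \<in> components ?D"
    then have "C \<subseteq> ?L \<or> C \<subseteq> ?U"
      by (intro sides in_components_connected in_components_subset)
    moreover have "?L \<subseteq> ?D" "?U \<subseteq> ?D"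
      by auto
    ultimately show "C \<in> components ?L \<union> components ?U"
      using components_intermediate_subset[OF C] by blast
  qed
  moreover have "components X \<subseteq> components ?D" if X: "X = ?L \<or> X = ?U" for X
  proof
    fix C assume C: "C \<in> components X"
    then have "C \<noteq> {}" "C \<subseteq> X" "connected C"
      by (auto simp: in_components_maximal)
    moreover have "E = C" if E: "C \<subseteq> E" "E \<subseteq> ?D" "connected E" for E
    proof -
      have "E \<subseteq> X"
        using sides[OF E(3,2)] X E(1) \<open>C \<noteq> {}\<close> \<open>C \<subseteq> X\<close> by fastforce
      then show ?thesis
        using C E \<open>C \<noteq> {}\<close> unfolding in_components_maximal by blast
    qed
    ultimately show "C \<in> components ?D"
      using X unfolding in_components_maximal[of C ?D] by auto
  qed
  ultimately show ?thesis by blast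
qed

lemma card_components_Diff_level_set_sides:
  fixes f :: "'a::topological_space \<Rightarrow> real"
  assumes "continuous_on G f"
    and "finite (components (G \<inter> {x. f x < c}))" "finite (components (G \<inter> {x. c < f x}))"
  shows "card (components (G - {x. f x = c}))
       = card (components (G \<inter> {x. f x < c})) + card (components (G \<inter> {x. c < f x}))"
  unfolding components_Diff_level_set[OF assms(1)]
proof (rule card_Un_disjoint[OF assms(2,3)])
  have "C = {}" if "C \<in> components (G \<inter> {x. f x < c})" "C \<in> components (G \<inter> {x. c < f x})" for C
    using in_components_subset[OF that(1)] in_components_subset[OF that(2)] by force
  then show "components (G \<inter> {x. f x < c}) \<inter> components (G \<inter> {x. c < f x}) = {}"
    using in_components_nonempty by blast
qed

lemma bij_betw_components_Int_convex:
  fixes G :: "('i \<Rightarrow> real) set"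
  assumes G: "\<And>R. R \<in> components G \<Longrightarrow> convex R" and K: "convex K"
  shows "bij_betw (\<lambda>R. R \<inter> K) {R \<in> components G. R \<inter> K \<noteq> {}} (components (G \<inter> K))"
proof -
  let ?M = "{R \<in> components G. R \<inter> K \<noteq> {}}"
  have "inj_on (\<lambda>R. R \<inter> K) ?M"
    by (rule inj_onI) (use components_eq in blast)
  moreover have Int_in: "R \<inter> K \<in> components (G \<inter> K)" if "R \<in> ?M" for R
  proof -
    have R: "R \<in> components G" "R \<inter> K \<noteq> {}"
      using that by auto
    then have "connected (R \<inter> K)"
      using G K by (simp add: convex_Int convex_imp_connected_fun)
    moreover have "E = R \<inter> K" if "R \<inter> K \<subseteq> E" "E \<subseteq> G \<inter> K" "connected E" for E
      using components_maximal[OF R(1), of E] R(2) that by blast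
    ultimately show ?thesis
      using R in_components_subset[OF R(1)] by (auto simp: in_components_maximal[of "R \<inter> K"])
  qed
  moreover have "C \<in> (\<lambda>R. R \<inter> K) ` ?M" if C: "C \<in> components (G \<inter> K)" for C
  proof -
    obtain x where x: "x \<in> C" "x \<in> G" "x \<in> K"
      using in_components_nonempty[OF C] in_components_subset[OF C] by blast
    then obtain R where R: "R \<in> components G" "x \<in> R"
      by (metis UnionE Union_components)
    then have "C = R \<inter> K"
      using x Int_in components_eq[OF C, of "R \<inter> K"] by blast
    then show ?thesis using R x by blast
  qed
  ultimately show ?thesis
    unfolding bij_betw_def by blast
qed

section \<open>Deletion and restriction\<close>

text \<open>A functional that is constant on \<^term>\<open>W\<close> is allowed; its hyperplane is then empty.\<close>

definition hyperplane_in :: "('i \<Rightarrow> real) set \<Rightarrow> ('i \<Rightarrow> real) set \<Rightarrow> bool" where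
  "hyperplane_in W H \<longleftrightarrow>
     (\<exists>f (c :: real). linear f \<and> continuous_on UNIV f \<and> H = {x \<in> W. f x = c}) \<and> H \<noteq> W"

lemma convex_components_Diff_hyperplanes:
  assumes W: "convex W" and A: "\<And>H. H \<in> A \<Longrightarrow> hyperplane_in W H"
    and R: "R \<in> components (W - \<Union>A)"
  shows "convex R"
  unfolding convex_contains_segment
proof (intro ballI)
  fix x y assume xy: "x \<in> R" "y \<in> R"
  have R_sub: "R \<subseteq> W - \<Union>A" "connected R"
    using R by (auto dest: in_components_subset in_components_connected)
  have "closed_segment x y \<inter> H = {}" if "H \<in> A" for H
  proof -
    obtain f and c :: real
      where f: "linear f" "continuous_on UNIV f" "H = {x \<in> W. f x = c}" "H \<noteq> W"
      using A[OF \<open>H \<in> A\<close>] unfolding hyperplane_in_def by blast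
    have "c \<notin> f ` R"
      using R_sub(1) f(3) that by blast
    then consider "R \<subseteq> {x. f x < c}" | "R \<subseteq> {x. c < f x}"
      using connected_on_one_side_of_level_set[OF R_sub(2) continuous_on_subset[OF f(2)]] by blast
    then have "closed_segment x y \<subseteq> {x. f x < c} \<or> closed_segment x y \<subseteq> {x. c < f x}"
      using xy convex_linear_sides[OF f(1)] by cases (meson closed_segment_subset subsetD)+
    then show ?thesis using f(3) by auto
  qed
  moreover have "closed_segment x y \<subseteq> W"
    using R_sub(1) xy by (intro closed_segment_subset W) auto
  ultimately have "closed_segment x y \<subseteq> W - \<Union>A" by blast
  then show "closed_segment x y \<subseteq> R"
    by (rule components_maximal[OF R convex_imp_connected_fun[OF convex_closed_segment]])
      (use xy(1) in auto)
qed

lemma finite_components_Diff_hyperplanes: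
  assumes W: "convex W" and "finite A" and "\<And>H. H \<in> A \<Longrightarrow> hyperplane_in W H"
  shows "finite (components (W - \<Union>A))"
  using assms(2,3)
proof (induction A rule: finite_induct)
  case empty
  have "components W \<subseteq> {W}"
    using W convex_imp_connected_fun connected_eq_components_subset_sing by blast
  then show ?case by (simp add: finite_subset)
next
  case (insert H A)
  let ?G = "W - \<Union>A"
  obtain f and c :: real
    where f: "linear f" "continuous_on UNIV f" "H = {x \<in> W. f x = c}" "H \<noteq> W"
    using insert.prems[OF insertI1] unfolding hyperplane_in_def by blast
  have "finite (components (?G \<inter> K))" if "convex K" for K
  proof -
    have "bij_betw (\<lambda>R. R \<inter> K) {R \<in> components ?G. R \<inter> K \<noteq> {}} (components (?G \<inter> K))"
      using convex_components_Diff_hyperplanes[OF W] insert.prems that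
      by (intro bij_betw_components_Int_convex) blast+
    then show ?thesis
      using insert by (simp add: bij_betw_finite[symmetric])
  qed
  moreover have "W - \<Union>(insert H A) = ?G - {x. f x = c}"
    using f(3) by auto
  ultimately show ?case
    by (simp only: components_Diff_level_set[OF continuous_on_subset[OF f(2) subset_UNIV]]
        finite_Un convex_linear_sides[OF f(1)])
qed

lemma open_line_vimage_Diff_hyperplanes:
  assumes W: "affine W" and "finite A" and A: "\<And>H. H \<in> A \<Longrightarrow> hyperplane_in W H"
    and "x \<in> W" "y \<in> W"
  shows "open {t. (1 - t) *\<^sub>R x + t *\<^sub>R y \<in> W - \<Union>A}"
proof -
  define p where "p t = (1 - t) *\<^sub>R x + t *\<^sub>R y" for t
  have p_W: "p t \<in> W" for t
    unfolding p_def using assms mem_affine[OF W, of x y "1 - t" t] by simp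
  have "closed (p -` H)" if "H \<in> A" for H
  proof -
    obtain f and c :: real
      where f: "linear f" "continuous_on UNIV f" "H = {x \<in> W. f x = c}" "H \<noteq> W"
      using A[OF \<open>H \<in> A\<close>] unfolding hyperplane_in_def by blast
    have "p -` H = {t. f (p t) = c}"
      using f(3) p_W by auto
    moreover have "continuous_on UNIV (\<lambda>t. f (p t))"
      unfolding p_def by (rule continuous_on_compose2[OF f(2) continuous_on_line]) auto
    ultimately show ?thesis
      by (simp add: closed_Collect_eq continuous_on_const)
  qed
  then have "open (- (\<Union>H\<in>A. p -` H))"
    using \<open>finite A\<close> by (intro open_Compl closed_UN) auto
  moreover have "- (\<Union>H\<in>A. p -` H) = {t. p t \<in> W - \<Union>A}"
    using p_W by auto
  ultimately show ?thesis by (simp add: p_def)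
qed

lemma component_Diff_hyperplanes_open_along_line:
  assumes W: "affine W" and A: "finite A" "\<And>H. H \<in> A \<Longrightarrow> hyperplane_in W H"
    and R: "R \<in> components (W - \<Union>A)" "x \<in> R" and "y \<in> W"
  obtains \<epsilon> where "\<epsilon> > 0" "\<And>t. \<bar>t\<bar> < \<epsilon> \<Longrightarrow> (1 - t) *\<^sub>R x + t *\<^sub>R y \<in> R"
proof -
  define p where "p t = (1 - t) *\<^sub>R x + t *\<^sub>R y" for t
  have x: "x \<in> W - \<Union>A" and p_0: "p 0 = x"
    using R in_components_subset by (blast, simp add: p_def)
  have "open {t. p t \<in> W - \<Union>A}"
    unfolding p_def using x \<open>y \<in> W\<close> by (intro open_line_vimage_Diff_hyperplanes W A) auto
  moreover have "0 \<in> {t. p t \<in> W - \<Union>A}"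
    using x p_0 by simp
  ultimately obtain \<epsilon> where \<epsilon>: "\<epsilon> > 0" "ball 0 \<epsilon> \<subseteq> {t. p t \<in> W - \<Union>A}"
    by (rule openE)
  have "p ` ball 0 \<epsilon> \<subseteq> R"
  proof (rule components_maximal[OF R(1)])
    have "connected (ball (0 :: real) \<epsilon>)"
      by (intro convex_connected convex_ball)
    then show "connected (p ` ball 0 \<epsilon>)"
      unfolding p_def by (intro connected_continuous_image continuous_on_line)
    show "p ` ball 0 \<epsilon> \<subseteq> W - \<Union>A"
      using \<epsilon>(2) by blast
    have "x \<in> p ` ball 0 \<epsilon>"
      using \<epsilon>(1) p_0 by (intro image_eqI[of _ _ 0]) simp_all
    then show "R \<inter> p ` ball 0 \<epsilon> \<noteq> {}"
      using R(2) by blast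
  qed
  then have "p t \<in> R" if "\<bar>t\<bar> < \<epsilon>" for t
    using that by (simp add: image_subset_iff)
  then show thesis
    using that[OF \<epsilon>(1)] by (simp add: p_def)
qed

lemma component_Diff_hyperplanes_crosses:
  assumes "affine W" "finite A" "\<And>H. H \<in> A \<Longrightarrow> hyperplane_in W H"
    and R: "R \<in> components (W - \<Union>A)" "x \<in> R"
    and f: "linear f" "f x = c" and nonconstant: "\<exists>w\<in>W. f w \<noteq> (c :: real)"
  shows "\<exists>y\<in>R. f y < c" "\<exists>z\<in>R. c < f z"
proof -
  obtain w where w: "w \<in> W" "f w \<noteq> c"
    using nonconstant by blast
  let ?p = "\<lambda>t. (1 - t) *\<^sub>R x + t *\<^sub>R w"
  obtain \<epsilon> where \<epsilon>: "\<epsilon> > 0" "\<And>t. \<bar>t\<bar> < \<epsilon> \<Longrightarrow> ?p t \<in> R"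
    using component_Diff_hyperplanes_open_along_line[OF assms(1-5) w(1)] by blast
  have in_R: "?p (\<epsilon> / 2) \<in> R" "?p (- \<epsilon> / 2) \<in> R"
    using \<epsilon>(1) by (intro \<epsilon>(2); simp)+
  have f_p: "f (?p t) = c + t * (f w - c)" for t
    unfolding linear_add[OF f(1)] linear_scale[OF f(1)] f(2) by (simp add: algebra_simps)
  consider "f w < c" | "c < f w" using w(2) by linarith
  then have "f (?p (\<epsilon> / 2)) < c \<and> c < f (?p (- \<epsilon> / 2)) \<or>
      f (?p (- \<epsilon> / 2)) < c \<and> c < f (?p (\<epsilon> / 2))"
    unfolding f_p using \<epsilon>(1) by cases (simp_all add: mult_pos_neg)
  then show "\<exists>y\<in>R. f y < c" "\<exists>z\<in>R. c < f z"
    using in_R by blast+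
qed

lemma card_components_Diff_level_set:
  fixes G :: "('i \<Rightarrow> real) set"
  assumes fin: "finite (components G)" and convex: "\<And>R. R \<in> components G \<Longrightarrow> convex R"
    and f: "linear f" "continuous_on G f"
    and crosses: "\<And>R. R \<in> components G \<Longrightarrow> R \<inter> {x. f x = c} \<noteq> {} \<Longrightarrow>
      R \<inter> {x. f x < c} \<noteq> {} \<and> R \<inter> {x. c < f x} \<noteq> {}"
  shows "card (components (G - {x. f x = (c :: real)}))
       = card (components G) + card (components (G \<inter> {x. f x = c}))"
proof -
  let ?L = "{x. f x < c}" and ?U = "{x. c < f x}" and ?E = "{x. f x = c}"
  define meeting where "meeting K = {R \<in> components G. R \<inter> K \<noteq> {}}" for K
  have fin_meeting: "finite (meeting K)" for K
    using fin by (simp add: meeting_def)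
  have bij: "bij_betw (\<lambda>R. R \<inter> K) (meeting K) (components (G \<inter> K))" if "K \<in> {?L, ?U, ?E}" for K
    unfolding meeting_def using convex that convex_linear_sides[OF f(1)]
    by (intro bij_betw_components_Int_convex) auto
  have union: "meeting ?L \<union> meeting ?U = components G"
  proof (intro equalityI subsetI)
    fix R assume R: "R \<in> components G"
    then obtain x where "x \<in> R"
      using in_components_nonempty by blast
    then show "R \<in> meeting ?L \<union> meeting ?U"
      using R crosses[OF R] by (cases "f x" c rule: linorder_cases) (auto simp: meeting_def)
  qed (auto simp: meeting_def)
  have inter: "meeting ?L \<inter> meeting ?U = meeting ?E"
  proof (intro equalityI subsetI)
    fix R assume "R \<in> meeting ?L \<inter> meeting ?U"
    then have R: "R \<in> components G" "R \<inter> ?L \<noteq> {}" "R \<inter> ?U \<noteq> {}"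
      by (auto simp: meeting_def)
    then have "R \<inter> ?E \<noteq> {}"
      using f(2) in_components_connected in_components_subset continuous_on_subset
      by (intro connected_meets_level_set) blast+
    then show "R \<in> meeting ?E"
      using R(1) by (simp add: meeting_def)
  qed (use crosses in \<open>auto simp: meeting_def\<close>)
  have "card (components (G - ?E)) = card (components (G \<inter> ?L)) + card (components (G \<inter> ?U))"
    using bij_betw_finite[OF bij] fin_meeting
    by (intro card_components_Diff_level_set_sides f(2)) auto
  also have "\<dots> = card (meeting ?L) + card (meeting ?U)"
    using bij_betw_same_card[OF bij] by simp
  also have "\<dots> = card (components G) + card (meeting ?E)"
    using card_Un_Int[OF fin_meeting fin_meeting, of ?L ?U] by (simp add: union inter)
  also have "card (meeting ?E) = card (components (G \<inter> ?E))"
    using bij_betw_same_card[OF bij] by simp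
  finally show ?thesis .
qed

theorem card_components_deletion_restriction:
  assumes W: "affine W" and "finite A" and HA: "\<And>K. K \<in> insert H A \<Longrightarrow> hyperplane_in W K"
  shows "card (components (W - \<Union>(insert H A)))
       = card (components (W - \<Union>A)) + card (components (H - \<Union>A))"
proof -
  let ?G = "W - \<Union>A"
  obtain f and c :: real
    where f: "linear f" "continuous_on UNIV f" and H: "H = {x \<in> W. f x = c}" "H \<noteq> W"
    using HA[OF insertI1] unfolding hyperplane_in_def by blast
  have A: "K \<in> A \<Longrightarrow> hyperplane_in W K" for K
    using HA by blast
  have "card (components (?G - {x. f x = c}))
      = card (components ?G) + card (components (?G \<inter> {x. f x = c}))"
  proof (rule card_components_Diff_level_set)
    show "finite (components ?G)"
      using finite_components_Diff_hyperplanes[OF affine_imp_convex[OF W] assms(2) A] .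
    show "convex R" if "R \<in> components ?G" for R
      using convex_components_Diff_hyperplanes[OF affine_imp_convex[OF W] A that] .
    show "R \<inter> {x. f x < c} \<noteq> {} \<and> R \<inter> {x. c < f x} \<noteq> {}"
      if "R \<in> components ?G" "R \<inter> {x. f x = c} \<noteq> {}" for R
      using component_Diff_hyperplanes_crosses[OF W assms(2) A that(1) _ f(1)] that(2) H by blast
  qed (fact f(1), rule continuous_on_subset[OF f(2) subset_UNIV])
  moreover have "?G - {x. f x = c} = W - \<Union>(insert H A)" "?G \<inter> {x. f x = c} = H - \<Union>A"
    using H by auto
  ultimately show ?thesis by simp
qed

section \<open>Changing the number of coordinates\<close>

lemma connected_component_continuous_image:
  assumes "continuous_on S f" "f ` S \<subseteq> T" "connected_component S x y"
  shows "connected_component T (f x) (f y)"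
proof -
  obtain U where "connected U" "U \<subseteq> S" "x \<in> U" "y \<in> U"
    using assms(3) unfolding connected_component_def by blast
  then have "connected (f ` U)" "f ` U \<subseteq> T" "f x \<in> f ` U" "f y \<in> f ` U"
    using assms(1,2) by (auto intro: connected_continuous_image continuous_on_subset)
  then show ?thesis
    unfolding connected_component_def by blast
qed

lemma image_connected_component_of_section:
  assumes f: "continuous_on S f" "f ` S \<subseteq> T" and g: "continuous_on T g" "g ` T \<subseteq> S"
    and fg: "\<And>y. y \<in> T \<Longrightarrow> f (g y) = y"
    and gf: "connected_component S x (g (f x))"
  shows "f ` connected_component_set S x = connected_component_set T (f x)"
proof
  show "f ` connected_component_set S x \<subseteq> connected_component_set T (f x)"
    using connected_component_continuous_image[OF f] by blast
  show "connected_component_set T (f x) \<subseteq> f ` connected_component_set S x"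
  proof
    fix y assume "y \<in> connected_component_set T (f x)"
    then have "y \<in> T" "connected_component S (g (f x)) (g y)"
      using connected_component_continuous_image[OF g] connected_component_in by fastforce+
    then have "g y \<in> connected_component_set S x" "f (g y) = y"
      using connected_component_trans[OF gf] fg by auto
    then show "y \<in> f ` connected_component_set S x"
      by force
  qed
qed

lemma card_components_eq_of_section:
  assumes f: "continuous_on S f" "f ` S \<subseteq> T" and g: "continuous_on T g" "g ` T \<subseteq> S"
    and fg: "\<And>y. y \<in> T \<Longrightarrow> f (g y) = y"
    and gf: "\<And>x. x \<in> S \<Longrightarrow> connected_component S x (g (f x))"
  shows "card (components S) = card (components T)"
proof (rule bij_betw_same_card, rule bij_betw_imageI)
  show "inj_on (image f) (components S)"
  proof (rule inj_onI)
    fix C C' assume C: "C \<in> components S" "C' \<in> components S" and eq: "f ` C = f ` C'"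
    obtain x x' where x: "x \<in> S" "C = connected_component_set S x"
      and x': "x' \<in> S" "C' = connected_component_set S x'"
      using C by (meson componentsE)
    have "f x \<in> f ` C"
      using x by simp
    then obtain z where "z \<in> C'" "f x = f z"
      using eq by auto
    moreover have "z \<in> S"
      using \<open>z \<in> C'\<close> in_components_subset[OF C(2)] by blast
    ultimately have "connected_component S x z"
      using gf[OF x(1)] gf[of z] by (metis connected_component_sym connected_component_trans)
    then show "C = C'"
      using \<open>z \<in> C'\<close> components_eq[OF C] x(2) by blast
  qed
  have "f ` S = T"
    using f(2) g(2) fg by force
  then have "components T = connected_component_set T ` f ` S"
    by (simp add: components_def)
  also have "\<dots> = image f ` components S"
    unfolding components_def image_image by (rule image_cong[OF refl])
      (simp add: image_connected_component_of_section[OF f g fg gf])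
  finally show "image f ` components S = components T" ..
qed

definition del_coord :: "nat \<Rightarrow> (nat \<Rightarrow> real) \<Rightarrow> nat \<Rightarrow> real" where
  "del_coord p x = (\<lambda>i. if i < p then x i else x (Suc i))"

definition ins_coord :: "nat \<Rightarrow> real \<Rightarrow> (nat \<Rightarrow> real) \<Rightarrow> nat \<Rightarrow> real" where
  "ins_coord p v y = (\<lambda>i. if i < p then y i else if i = p then v else y (i - 1))"

lemma del_coord_below: "i < p \<Longrightarrow> del_coord p x i = x i"
  and del_coord_above: "p \<le> i \<Longrightarrow> del_coord p x i = x (Suc i)"
  by (simp_all add: del_coord_def)

lemma ins_coord_same [simp]: "ins_coord p v y p = v"
  by (simp add: ins_coord_def)

lemma del_coord_ins_coord [simp]: "del_coord p (ins_coord p v y) = y"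
  by (auto simp: del_coord_def ins_coord_def)

lemma ins_coord_del_coord [simp]: "ins_coord p v (del_coord p x) = x(p := v)"
  by (auto simp: del_coord_def ins_coord_def fun_eq_iff)

lemma del_coord_upd [simp]: "del_coord p (x(p := v)) = del_coord p x"
  by (auto simp: del_coord_def)

lemma ins_coord_in_Rn:
  assumes "p \<in> {1..Suc n}" "y \<in> Rn n"
  shows "ins_coord p v y \<in> Rn (Suc n)"
  unfolding Rn_def
proof (intro CollectI allI impI)
  fix i assume "i \<notin> {1..Suc n}"
  then have "i - 1 \<notin> {1..n}" "i \<notin> {1..n}" "i \<noteq> p"
    using assms(1) by auto
  then show "ins_coord p v y i = 0"
    using assms(2) by (simp add: Rn_def ins_coord_def)
qed

lemma del_coord_in_Rn:
  assumes "p \<in> {1..Suc n}" "x \<in> Rn (Suc n)"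
  shows "del_coord p x \<in> Rn n"
  using assms by (auto simp: Rn_def del_coord_def)

lemma continuous_on_coord: "continuous_on S (\<lambda>x. x i :: 'a::topological_space)"
  by (rule continuous_on_subset[OF continuous_on_product_coordinates subset_UNIV])

lemma continuous_on_del_coord: "continuous_on S (del_coord p)"
proof (rule continuous_on_coordinatewise_then_product)
  show "continuous_on S (\<lambda>x. del_coord p x i)" for i
    by (cases "i < p") (simp_all add: del_coord_def continuous_on_coord)
qed

lemma continuous_on_ins_coord:
  assumes "continuous_on S \<phi>"
  shows "continuous_on S (\<lambda>y. ins_coord p (\<phi> y) y)"
proof (rule continuous_on_coordinatewise_then_product)
  show "continuous_on S (\<lambda>y. ins_coord p (\<phi> y) y i)" for i
    by (cases i p rule: linorder_cases) (simp_all add: ins_coord_def continuous_on_coord assms)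
qed

lemma card_components_coord_determined:
  assumes p: "p \<in> {1..Suc n}" and T: "T \<subseteq> Rn n" and \<phi>: "continuous_on T \<phi>"
    and S: "S = {x \<in> Rn (Suc n). del_coord p x \<in> T \<and> x p = \<phi> (del_coord p x)}"
  shows "card (components S) = card (components T)"
proof (rule card_components_eq_of_section)
  show "continuous_on S (del_coord p)" "continuous_on T (\<lambda>y. ins_coord p (\<phi> y) y)"
    by (rule continuous_on_del_coord, rule continuous_on_ins_coord[OF \<phi>])
  show "(\<lambda>y. ins_coord p (\<phi> y) y) ` T \<subseteq> S"
    using T ins_coord_in_Rn[OF p] by (auto simp: S)
  show "connected_component S x (ins_coord p (\<phi> (del_coord p x)) (del_coord p x))"
    if "x \<in> S" for x
  proof -
    have "ins_coord p (\<phi> (del_coord p x)) (del_coord p x) = x"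
      using that by (simp add: S fun_upd_idem)
    then show ?thesis
      using that by simp
  qed
qed (auto simp: S)

lemma card_components_coord_free:
  assumes p: "p \<in> {1..Suc n}" and T: "T \<subseteq> Rn n"
    and S: "S = {x \<in> Rn (Suc n). del_coord p x \<in> T}"
  shows "card (components S) = card (components T)"
proof (rule card_components_eq_of_section)
  show "continuous_on S (del_coord p)" "continuous_on T (ins_coord p 0)"
    by (rule continuous_on_del_coord, rule continuous_on_ins_coord[OF continuous_on_const])
  show "ins_coord p 0 ` T \<subseteq> S"
    using T ins_coord_in_Rn[OF p] by (auto simp: S)
  show "connected_component S x (ins_coord p 0 (del_coord p x))" if x: "x \<in> S" for x
  proof -
    let ?fibre = "range (\<lambda>v. x(p := v))"
    have "continuous_on UNIV (\<lambda>v. (x(p := v)) i)" for i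
      by (cases "i = p") simp_all
    then have "continuous_on UNIV (\<lambda>v. x(p := v))"
      by (rule continuous_on_coordinatewise_then_product)
    then have "connected ?fibre"
      by (intro connected_continuous_image connected_UNIV)
    moreover have "?fibre \<subseteq> S"
      using x p by (auto simp: S Rn_def)
    moreover have "x \<in> ?fibre" "x(p := 0) \<in> ?fibre"
      using rangeI[of "\<lambda>v. x(p := v)" "x p"] by auto
    ultimately show ?thesis
      unfolding ins_coord_del_coord connected_component_def by blast
  qed
qed (auto simp: S)

section \<open>The interpolating arrangements\<close>

lemma regions_eq_components: "regions n A = components (Rn n - \<Union>A)"
  by (auto simp: regions_def components_def)

lemma affine_Rn: "affine (Rn n)"
  by (auto simp: affine_def Rn_def)

lemma hyperplane_in_hyp:
  assumes "i \<in> {1..n}" "i \<noteq> j"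
  shows "hyperplane_in (Rn n) (hyp n i j c)"
  unfolding hyperplane_in_def
proof (intro conjI exI)
  show "linear (\<lambda>x :: nat \<Rightarrow> real. x i - x j)"
    by (rule linearI) (simp_all add: algebra_simps)
  show "continuous_on UNIV (\<lambda>x :: nat \<Rightarrow> real. x i - x j)"
    by (intro continuous_intros continuous_on_coord)
  show "hyp n i j c = {x \<in> Rn n. x i - x j = c}"
    by (simp add: hyp_def)
  have "(\<lambda>_. 0)(i := c + 1) \<in> Rn n - hyp n i j c"
    using assms by (auto simp: Rn_def hyp_def)
  then show "hyp n i j c \<noteq> Rn n" by blast
qed

text \<open>For \<^term>\<open>M = m + 1\<close> this is the arrangement \<^const>\<open>arr\<close>; allowing
  \<^term>\<open>M = 0\<close> provides the base of the recursion.\<close>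

definition interp_arr :: "nat \<Rightarrow> nat \<Rightarrow> nat \<Rightarrow> (nat \<Rightarrow> real) set set" where
  "interp_arr n M k =
     (\<Union>j\<in>{2..n}. (\<lambda>c. hyp n 1 j (real c)) ` {..<if j < k then M else Suc M})
   \<union> (\<Union>j\<in>{2..n}. \<Union>i\<in>{2..<j}. {hyp n i j 0, hyp n i j 1})"

definition off_walls :: "nat \<Rightarrow> nat \<Rightarrow> nat \<Rightarrow> (nat \<Rightarrow> real) \<Rightarrow> bool" where
  "off_walls n M k x \<longleftrightarrow>
     (\<forall>j\<in>{2..n}. \<forall>c<if j < k then M else Suc M. x 1 - x j \<noteq> real c)
   \<and> (\<forall>j\<in>{2..n}. \<forall>i\<in>{2..<j}. x i - x j \<notin> {0, 1})"

lemma Rn_Diff_interp_arr: "Rn n - \<Union>(interp_arr n M k) = {x \<in> Rn n. off_walls n M k x}"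
  unfolding interp_arr_def off_walls_def hyp_def lessThan_iff[symmetric] by blast

lemma Rn_Diff_shi:
  "Rn n - \<Union>(shi n) = {x \<in> Rn n. \<forall>j\<in>{1..n}. \<forall>i\<in>{1..<j}. x i - x j \<notin> {0, 1}}"
proof -
  have "shi n = (\<Union>j\<in>{1..n}. \<Union>i\<in>{1..<j}. {hyp n i j 0, hyp n i j 1})"
    unfolding shi_def by fastforce
  then show ?thesis
    by (auto simp: hyp_def)
qed

lemma arr_eq_interp_arr:
  assumes "2 \<le> k" "k \<le> n + 1"
  shows "arr n m k = interp_arr n (Suc m) k"
proof -
  have "(\<Union>j\<in>{2..n}. (\<lambda>c. hyp n 1 j (real c)) ` {..<if j < k then Suc m else Suc (Suc m)})
      = (\<Union>j\<in>{2..<k} \<union> {k..n}. (\<lambda>c. hyp n 1 j (real c)) ` {..if j < k then m else m + 1})"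
    using assms by (intro SUP_cong) (auto simp: lessThan_Suc_atMost)
  also have "\<dots> = {hyp n 1 j (real c) | j c. 2 \<le> j \<and> j < k \<and> c \<le> m}
      \<union> {hyp n 1 j (real c) | j c. k \<le> j \<and> j \<le> n \<and> c \<le> m + 1}"
    unfolding UN_Un by (intro arg_cong2[where f = "(\<union>)"]) force+
  moreover have "(\<Union>j\<in>{2..n}. \<Union>i\<in>{2..<j}. {hyp n i j 0, hyp n i j 1})
      = {hyp n i j c | i j c. 2 \<le> i \<and> i < j \<and> j \<le> n \<and> (c = 0 \<or> c = 1)}"
    by fastforce
  ultimately show ?thesis
    by (simp add: arr_def interp_arr_def)
qed

lemma shi_eq_interp_arr: "shi n = interp_arr n 1 2"
proof -
  let ?V = "\<lambda>j. {hyp n 1 j 0, hyp n 1 j 1}" and ?P = "\<lambda>j. \<Union>i\<in>{2..<j}. {hyp n i j 0, hyp n i j 1}"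
  have "shi n = (\<Union>j\<in>{2..n}. \<Union>i\<in>{1..<j}. {hyp n i j 0, hyp n i j 1})"
    unfolding shi_def by fastforce
  also have "\<dots> = (\<Union>j\<in>{2..n}. \<Union>i\<in>insert 1 {2..<j}. {hyp n i j 0, hyp n i j 1})"
    by (intro SUP_cong) auto
  also have "\<dots> = (\<Union>j\<in>{2..n}. ?V j) \<union> (\<Union>j\<in>{2..n}. ?P j)"
    by (simp only: UN_insert UN_Un_distrib)
  also have "\<dots> = interp_arr n 1 2"
    unfolding interp_arr_def
    by (intro arg_cong2[where f = "(\<union>)"] SUP_cong) (auto simp: lessThan_Suc)
  finally show ?thesis .
qed

lemma finite_interp_arr: "finite (interp_arr n M k)"
  by (simp add: interp_arr_def)

lemma hyperplane_in_interp_arr: "H \<in> interp_arr n M k \<Longrightarrow> hyperplane_in (Rn n) H"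
  unfolding interp_arr_def by (auto intro!: hyperplane_in_hyp)

lemma interp_arr_delete:
  assumes "2 \<le> k" "k \<le> n"
  shows "interp_arr n M k = insert (hyp n 1 k (real M)) (interp_arr n M (Suc k))"
proof -
  let ?W = "\<lambda>j a. (\<lambda>c. hyp n 1 j (real c)) ` {..<a}"
  have split_k: "{2..n} = insert k ({2..n} - {k})"
    using assms by auto
  have "(\<Union>j\<in>{2..n} - {k}. ?W j (if j < k then M else Suc M))
      = (\<Union>j\<in>{2..n} - {k}. ?W j (if j < Suc k then M else Suc M))"
    by (intro SUP_cong) auto
  moreover have "?W k (Suc M) = insert (hyp n 1 k (real M)) (?W k M)"
    by (simp add: lessThan_Suc)
  ultimately have "(\<Union>j\<in>{2..n}. ?W j (if j < k then M else Suc M))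
      = insert (hyp n 1 k (real M)) (\<Union>j\<in>{2..n}. ?W j (if j < Suc k then M else Suc M))"
    by (subst (1 2) split_k)
      (simp only: UN_insert Un_insert_left less_irrefl lessI if_True if_False)
  then show ?thesis
    by (simp add: interp_arr_def)
qed

lemma interp_arr_wrap: "interp_arr n (Suc M) (Suc n) = interp_arr n M 2"
  unfolding interp_arr_def by (intro arg_cong2[where f = "(\<union>)"] SUP_cong) auto

lemma card_regions_interp_arr_deletion_restriction:
  assumes "2 \<le> k" "k \<le> n"
  shows "card (regions n (interp_arr n M k))
       = card (regions n (interp_arr n M (Suc k)))
       + card (components (hyp n 1 k (real M) - \<Union>(interp_arr n M (Suc k))))"
  unfolding regions_eq_components interp_arr_delete[OF assms]
proof (rule card_components_deletion_restriction[OF affine_Rn finite_interp_arr])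
  show "hyperplane_in (Rn n) K"
    if "K \<in> insert (hyp n 1 k (real M)) (interp_arr n M (Suc k))" for K
    using that hyperplane_in_interp_arr[of K n M k] unfolding interp_arr_delete[OF assms] by blast
qed

lemma off_walls_del_coord:
  assumes k: "2 \<le> k" "k \<le> Suc n" and x: "x 1 - x k = real (Suc m)"
    and off: "off_walls (Suc n) (Suc m) (Suc k) x"
  shows "off_walls n (Suc (Suc m)) k (del_coord k x)"
proof -
  let ?y = "del_coord k x"
  have wall: "x 1 - x j \<noteq> real c"
    if "j \<in> {2..Suc n}" "c < (if j < Suc k then Suc m else Suc (Suc m))" for j c
    using off that unfolding off_walls_def by blast
  have pair: "x i \<noteq> x j \<and> x i - x j \<noteq> 1" if "j \<in> {2..Suc n}" "i \<in> {2..<j}" for i j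
    using off that unfolding off_walls_def by auto
  have y_1: "?y 1 = x 1"
    using k by (simp add: del_coord_below)
  have "?y 1 - ?y j \<noteq> real c"
    if j: "j \<in> {2..n}" and c: "c < (if j < k then Suc (Suc m) else Suc (Suc (Suc m)))" for j c
  proof (cases "j < k")
    case True
    then have "x 1 - x j \<noteq> real (Suc m)"
      using pair[of k j] j k x by auto
    moreover have "x 1 - x j \<noteq> real c" if "c < Suc m"
      using wall[of j c] that j True by auto
    ultimately have "x 1 - x j \<noteq> real c"
      using True c by (auto simp: less_Suc_eq)
    then show ?thesis
      unfolding y_1 del_coord_below[OF True] .
  next
    case False
    then have "x 1 - x (Suc j) \<noteq> real (Suc (Suc m))"
      using pair[of "Suc j" k] j k x by auto
    moreover have "x 1 - x (Suc j) \<noteq> real c" if "c < Suc (Suc m)"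
      using wall[of "Suc j" c] that j False by auto
    ultimately have "x 1 - x (Suc j) \<noteq> real c"
      using False c by (auto simp: less_Suc_eq)
    then show ?thesis
      unfolding y_1 del_coord_above[OF leI[OF False]] .
  qed
  moreover have "?y i - ?y j \<notin> {0, 1}" if "j \<in> {2..n}" "i \<in> {2..<j}" for i j
    using pair[of "if j < k then j else Suc j" "if i < k then i else Suc i"] that
    by (auto simp: del_coord_def)
  ultimately show ?thesis
    unfolding off_walls_def by blast
qed

lemma off_walls_del_coordD:
  assumes k: "2 \<le> k" and off: "off_walls n M k (del_coord k x)"
  shows "j \<in> {2..<k} \<Longrightarrow> k \<le> Suc n \<Longrightarrow> c < M \<Longrightarrow> x 1 - x j \<noteq> real c"
    and "j \<in> {Suc k..Suc n} \<Longrightarrow> c < Suc M \<Longrightarrow> x 1 - x j \<noteq> real c"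
proof -
  let ?y = "del_coord k x"
  have y_1: "?y 1 = x 1"
    using k by (simp add: del_coord_below)
  have wall: "x 1 - ?y j \<noteq> real c" if "j \<in> {2..n}" "c < (if j < k then M else Suc M)" for j c
    using off that unfolding off_walls_def y_1 by blast
  show "x 1 - x j \<noteq> real c" if "j \<in> {2..<k}" "k \<le> Suc n" "c < M"
    using wall[of j c] that by (auto simp: del_coord_below)
  show "x 1 - x j \<noteq> real c" if "j \<in> {Suc k..Suc n}" "c < Suc M"
  proof -
    have "?y (j - 1) = x j" "j - 1 \<in> {2..n}" "\<not> j - 1 < k"
      using that(1) k by (auto simp: del_coord_def)
    then show ?thesis
      using wall[of "j - 1" c] that(2) by simp
  qed
qed

lemma off_walls_of_del_coord:
  assumes k: "2 \<le> k" "k \<le> Suc n" and x: "x 1 - x k = real (Suc m)"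
    and off: "off_walls n (Suc (Suc m)) k (del_coord k x)"
  shows "off_walls (Suc n) (Suc m) (Suc k) x"
proof -
  let ?y = "del_coord k x"
  note wall_below = off_walls_del_coordD(1)[OF k(1) off _ k(2)]
    and wall_above = off_walls_del_coordD(2)[OF k(1) off]
  have "x 1 - x j \<noteq> real c"
    if "j \<in> {2..Suc n}" "c < (if j < Suc k then Suc m else Suc (Suc m))" for j c
    using that x wall_below[of j c] wall_above[of j c]
    by (cases j k rule: linorder_cases) auto
  moreover have "x i - x j \<notin> {0, 1}" if j: "j \<in> {2..Suc n}" and i: "i \<in> {2..<j}" for i j
  proof -
    consider (upper) "j = k" | (lower) "i = k" | (neither) "i \<noteq> k" "j \<noteq> k" by blast
    then show ?thesis
    proof cases
      case upper
      then have "x 1 - x i \<noteq> real (Suc m)" "x 1 - x i \<noteq> real m"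
        using wall_below[of i "Suc m"] wall_below[of i m] i by simp_all
      then show ?thesis
        using x upper by auto
    next
      case lower
      then have "x 1 - x j \<noteq> real (Suc m)" "x 1 - x j \<noteq> real (Suc (Suc m))"
        using wall_above[of j "Suc m"] wall_above[of j "Suc (Suc m)"] i j by simp_all
      then show ?thesis
        using x lower by auto
    next
      case neither
      let ?i = "if i < k then i else i - 1" and ?j = "if j < k then j else j - 1"
      have "?j \<in> {2..n}" "?i \<in> {2..<?j}"
        using i j k neither by auto
      then have "?y ?i - ?y ?j \<notin> {0, 1}"
        using off unfolding off_walls_def by blast
      then show ?thesis
        using neither by (auto simp: del_coord_def split: if_splits)
    qed
  qed
  ultimately show ?thesis
    unfolding off_walls_def by blast
qed

lemma card_components_restriction_interp_arr_Suc:
  assumes k: "2 \<le> k" "k \<le> Suc n"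
  shows "card (components (hyp (Suc n) 1 k (real (Suc m)) - \<Union>(interp_arr (Suc n) (Suc m) (Suc k))))
       = card (regions n (interp_arr n (Suc (Suc m)) k))"
proof -
  let ?\<phi> = "\<lambda>y :: nat \<Rightarrow> real. y 1 - real (Suc m)"
  have "hyp (Suc n) 1 k (real (Suc m)) - \<Union>(interp_arr (Suc n) (Suc m) (Suc k))
      = {x \<in> Rn (Suc n) - \<Union>(interp_arr (Suc n) (Suc m) (Suc k)). x 1 - x k = real (Suc m)}"
    by (auto simp: hyp_def)
  also have "\<dots> = {x \<in> Rn (Suc n). del_coord k x \<in> Rn n - \<Union>(interp_arr n (Suc (Suc m)) k)
      \<and> x k = ?\<phi> (del_coord k x)}"
  proof -
    have "off_walls (Suc n) (Suc m) (Suc k) x \<and> x 1 - x k = real (Suc m) \<longleftrightarrow>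
        off_walls n (Suc (Suc m)) k (del_coord k x) \<and> x k = ?\<phi> (del_coord k x)" for x
    proof -
      have "x k = ?\<phi> (del_coord k x) \<longleftrightarrow> x 1 - x k = real (Suc m)"
        using k by (auto simp: del_coord_below)
      then show ?thesis
        using off_walls_del_coord[OF k] off_walls_of_del_coord[OF k] by blast
    qed
    moreover have "x \<in> Rn (Suc n) \<Longrightarrow> del_coord k x \<in> Rn n" for x
      using del_coord_in_Rn k by simp
    ultimately show ?thesis
      unfolding Rn_Diff_interp_arr by blast
  qed
  finally show ?thesis
    unfolding regions_eq_components
    by (intro card_components_coord_determined[of k n _ ?\<phi>])
      (use k in \<open>auto intro!: continuous_intros continuous_on_coord\<close>)
qed

lemma Rn_Diff_interp_arr_0:
  assumes "1 \<le> k"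
  shows "Rn (Suc n) - \<Union>(interp_arr (Suc n) 0 (Suc k))
       = {x \<in> Rn (Suc n). del_coord 1 x \<in> Rn n - \<Union>(shi n) \<and> (\<forall>j\<in>{Suc k..Suc n}. x 1 \<noteq> x j)}"
proof -
  have "off_walls (Suc n) 0 (Suc k) x \<longleftrightarrow>
      (\<forall>j\<in>{1..n}. \<forall>i\<in>{1..<j}. del_coord 1 x i - del_coord 1 x j \<notin> {0, 1})
      \<and> (\<forall>j\<in>{Suc k..Suc n}. x 1 \<noteq> x j)" for x
  proof -
    have shift: "{2..Suc n} = Suc ` {1..n}" "{2..<Suc j} = Suc ` {1..<j}" for j
      by (simp_all add: numeral_2_eq_2)
    have "(\<forall>j\<in>{2..Suc n}. \<forall>i\<in>{2..<j}. x i - x j \<notin> {0, 1}) \<longleftrightarrow>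
        (\<forall>j\<in>{1..n}. \<forall>i\<in>{1..<j}. x (Suc i) - x (Suc j) \<notin> {0, 1})"
      unfolding shift ball_simps ..
    also have "\<dots> \<longleftrightarrow> (\<forall>j\<in>{1..n}. \<forall>i\<in>{1..<j}. del_coord 1 x i - del_coord 1 x j \<notin> {0, 1})"
      by (simp add: del_coord_above)
    finally have pairs: "(\<forall>j\<in>{2..Suc n}. \<forall>i\<in>{2..<j}. x i - x j \<notin> {0, 1}) \<longleftrightarrow>
        (\<forall>j\<in>{1..n}. \<forall>i\<in>{1..<j}. del_coord 1 x i - del_coord 1 x j \<notin> {0, 1})" .
    have "{Suc k..Suc n} = {2..Suc n} \<inter> {j. \<not> j < Suc k}"
      using assms by auto
    then have "(\<forall>j\<in>{2..Suc n}. \<forall>c<if j < Suc k then 0 else Suc 0. x 1 - x j \<noteq> real c) \<longleftrightarrow>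
        (\<forall>j\<in>{Suc k..Suc n}. x 1 \<noteq> x j)"
      by auto
    then show ?thesis
      unfolding off_walls_def pairs by blast
  qed
  then show ?thesis
    unfolding Rn_Diff_interp_arr Rn_Diff_shi using del_coord_in_Rn[of 1 n] by auto
qed

lemma card_regions_interp_arr_0_top:
  "card (regions (Suc n) (interp_arr (Suc n) 0 (Suc (Suc n)))) = card (regions n (shi n))"
  unfolding regions_eq_components
  by (rule card_components_coord_free[of 1 n]) (auto simp: Rn_Diff_interp_arr_0)

lemma card_components_restriction_interp_arr_0:
  assumes k: "2 \<le> k" "k \<le> Suc n"
  shows "card (components (hyp (Suc n) 1 k 0 - \<Union>(interp_arr (Suc n) 0 (Suc k))))
       = card (regions n (shi n))"
proof -
  let ?\<phi> = "\<lambda>y :: nat \<Rightarrow> real. y (k - 1)"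
  have x_1_neq: "x 1 \<noteq> x j"
    if "del_coord 1 x \<in> Rn n - \<Union>(shi n)" "x 1 = x k" "j \<in> {Suc k..Suc n}" for x j
  proof -
    have "j - 1 \<in> {1..n}" "k - 1 \<in> {1..<j - 1}"
      using that(3) k by auto
    then have "del_coord 1 x (k - 1) - del_coord 1 x (j - 1) \<notin> {0, 1}"
      using that(1) unfolding Rn_Diff_shi by blast
    moreover have "del_coord 1 x (k - 1) = x k" "del_coord 1 x (j - 1) = x j"
      using that(3) k by (auto simp: del_coord_def)
    ultimately show ?thesis
      using that(2) by simp
  qed
  have "hyp (Suc n) 1 k 0 - \<Union>(interp_arr (Suc n) 0 (Suc k))
      = {x \<in> Rn (Suc n) - \<Union>(interp_arr (Suc n) 0 (Suc k)). x 1 = x k}"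
    by (auto simp: hyp_def)
  also have "\<dots> = {x \<in> Rn (Suc n). del_coord 1 x \<in> Rn n - \<Union>(shi n) \<and> x 1 = x k}"
    using k x_1_neq by (subst Rn_Diff_interp_arr_0) (simp, blast)
  also have "\<dots> = {x \<in> Rn (Suc n). del_coord 1 x \<in> Rn n - \<Union>(shi n) \<and> x 1 = ?\<phi> (del_coord 1 x)}"
    using k by (simp add: del_coord_above)
  finally show ?thesis
    unfolding regions_eq_components
    by (intro card_components_coord_determined[of 1 n _ ?\<phi>]) (auto intro!: continuous_on_coord)
qed

section \<open>Counting\<close>

lemma card_regions_interp_arr_0:
  assumes "2 \<le> k" "k \<le> n + 2"
  shows "card (regions (Suc n) (interp_arr (Suc n) 0 k)) = (n + 3 - k) * card (regions n (shi n))"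
  using assms(2,1)
proof (induction k rule: inc_induct)
  case base
  show ?case
    using card_regions_interp_arr_0_top by simp
next
  case (step k)
  then have k: "2 \<le> k" "k \<le> Suc n" by auto
  have "card (regions (Suc n) (interp_arr (Suc n) 0 k))
      = card (regions (Suc n) (interp_arr (Suc n) 0 (Suc k))) + card (regions n (shi n))"
    using card_regions_interp_arr_deletion_restriction[OF k, of 0]
      card_components_restriction_interp_arr_0[OF k] by simp
  also have "\<dots> = Suc (n + 3 - Suc k) * card (regions n (shi n))"
    using step by simp
  also have "Suc (n + 3 - Suc k) = n + 3 - k"
    using k by simp
  finally show ?case .
qed

lemma card_regions_interp_arr_1_top:
  "card (regions (Suc n) (interp_arr (Suc n) 1 (n + 2))) = (n + 1) * card (regions n (shi n))"
  using interp_arr_wrap[of "Suc n" 0] card_regions_interp_arr_0[of 2 n] by simp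

lemma card_regions_interp_arr_from_top:
  assumes top: "card (regions (Suc n) (interp_arr (Suc n) (Suc m) (n + 2))) = (n + m + 1) ^ n"
    and smaller: "\<And>k. 2 \<le> k \<Longrightarrow> k \<le> n + 1 \<Longrightarrow>
      card (regions n (interp_arr n (Suc (Suc m)) k))
        = (n + m + 1) ^ (k - 2) * (n + m + 2) ^ (n + 1 - k)"
    and "2 \<le> k" "k \<le> n + 2"
  shows "card (regions (Suc n) (interp_arr (Suc n) (Suc m) k))
       = (n + m + 1) ^ (k - 2) * (n + m + 2) ^ (n + 2 - k)"
  using assms(4,3)
proof (induction k rule: inc_induct)
  case base
  then show ?case using top by simp
next
  case (step k)
  then have k: "2 \<le> k" "k \<le> Suc n" by auto
  let ?a = "n + m + 1"
  have "card (regions (Suc n) (interp_arr (Suc n) (Suc m) k))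
      = card (regions (Suc n) (interp_arr (Suc n) (Suc m) (Suc k)))
      + card (regions n (interp_arr n (Suc (Suc m)) k))"
    using card_regions_interp_arr_deletion_restriction[OF k]
      card_components_restriction_interp_arr_Suc[OF k] by simp
  also have "\<dots> = ?a ^ (Suc k - 2) * (?a + 1) ^ (n + 1 - k)
      + ?a ^ (k - 2) * (?a + 1) ^ (n + 1 - k)"
    using step k smaller[of k] by simp
  also have "Suc k - 2 = Suc (k - 2)"
    using k by simp
  also have "?a ^ Suc (k - 2) * (?a + 1) ^ (n + 1 - k) + ?a ^ (k - 2) * (?a + 1) ^ (n + 1 - k)
      = ?a ^ (k - 2) * (?a + 1) ^ Suc (n + 1 - k)"
    by (simp add: algebra_simps)
  also have "Suc (n + 1 - k) = n + 2 - k"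
    using k by simp
  finally show ?case by simp
qed

lemma regions_empty: "regions n {} = {Rn n}"
proof -
  have "Rn n \<noteq> {}"
    by (auto simp: Rn_def)
  then show ?thesis
    unfolding regions_eq_components
    using convex_imp_connected_fun[OF affine_imp_convex[OF affine_Rn]]
    by (simp add: components_eq_sing_iff)
qed

lemma card_regions_interp_arr:
  assumes "1 \<le> n" "2 \<le> k" "k \<le> n + 1"
  shows "card (regions n (interp_arr n (Suc m) k)) = (n + m) ^ (k - 2) * (n + m + 1) ^ (n + 1 - k)"
  using assms
proof (induction n arbitrary: m k rule: dec_induct)
  case base
  then have "interp_arr 1 (Suc m) k = {}"
    by (simp add: interp_arr_def)
  then show ?case
    using base by (simp add: regions_empty)
next
  case (step n)
  have from_top: "card (regions (Suc n) (interp_arr (Suc n) (Suc m) k))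
       = (n + m + 1) ^ (k - 2) * (n + m + 2) ^ (n + 2 - k)"
    if "card (regions (Suc n) (interp_arr (Suc n) (Suc m) (n + 2))) = (n + m + 1) ^ n"
      and "2 \<le> k" "k \<le> n + 2" for m k
    using card_regions_interp_arr_from_top[OF that(1) _ that(2,3)] step.IH[of _ "Suc m"] by simp
  have "card (regions (Suc n) (interp_arr (Suc n) (Suc m) (n + 2))) = (n + m + 1) ^ n" for m
  proof (induction m)
    case 0
    have "card (regions (Suc n) (interp_arr (Suc n) (Suc 0) (n + 2)))
        = (n + 1) * card (regions n (shi n))"
      using card_regions_interp_arr_1_top by simp
    also have "card (regions n (shi n)) = (n + 1) ^ (n - 1)"
      using step.IH[of 2 0] step.hyps by (simp add: shi_eq_interp_arr)
    also have "(n + 1) * (n + 1) ^ (n - 1) = (n + 1) ^ n"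
      using step.hyps by (simp flip: power_Suc)
    finally show ?case by simp
  next
    case (Suc m)
    have "card (regions (Suc n) (interp_arr (Suc n) (Suc (Suc m)) (n + 2)))
        = card (regions (Suc n) (interp_arr (Suc n) (Suc m) 2))"
      using interp_arr_wrap[of "Suc n" "Suc m"] by simp
    also have "\<dots> = (n + m + 2) ^ n"
      using from_top[OF Suc.IH, of 2] by simp
    finally show ?case by simp
  qed
  then show ?case
    using from_top[of m k] step.prems by simp
qed

theorem theorem4p1:
  fixes n m k :: nat
  assumes "1 \<le> n" and "2 \<le> k" and "k \<le> n + 1"
  shows "card (regions n (arr n m k)) = (n + m) ^ (k - 2) * (n + m + 1) ^ (n + 1 - k)
         \<and> card (regions n (shi n)) = (n + 1) ^ (n - 1)"
proof
  show "card (regions n (arr n m k)) = (n + m) ^ (k - 2) * (n + m + 1) ^ (n + 1 - k)"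
    unfolding arr_eq_interp_arr[OF assms(2,3)] by (rule card_regions_interp_arr[OF assms])
  show "card (regions n (shi n)) = (n + 1) ^ (n - 1)"
    using card_regions_interp_arr[of n 2 0] assms(1) by (simp add: shi_eq_interp_arr)
qed

end
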